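(* Let $M\in\mathrm{P}(n)$, let $N\in\mathrm{D}(n)$, and set $W_1=M^{-1}$. Then, up to scaling by $1/2$, Brockett's flow on $\mathrm{O}(n)$, $$\dot Q=-Q\left(NQ^\top MQ-Q^\top MQN\right),$$ is the pullback entropy gradient flow $\dot Q=\nabla_{\mathcal H}F(Q)$ on $\mathrm{O}(n)$; that is, $$\nabla_{\mathcal H}F(Q)=-\frac12\,Q\left(NQ^\top MQ-Q^\top MQN\right)\qquad\text{for all }Q\in\mathrm{O}(n).$$
   Context: $\mathrm{P}(n)$ is the set of real symmetric positive definite $n\times n$ matrices and $\mathrm{D}(n)\subset\mathrm{P}(n)$ the set of diagonal matrices with positive entries. The pullback entropy is $F(Q)=H(\Gamma(Q))$, where $\Gamma(Q)=Q^\top W_1Q$ and $$H(W)=\frac n2-\frac12\operatorname{tr}(NW^{-1})+\frac12\log\det(NW^{-1}),\qquad W\in\mathrm{P}(n).$$ On $\mathrm{O}(n)$ one uses the bi-invariant nondegenerate symmetric bilinear form $\mathcal H_Q(U,V)=\operatorname{tr}(Q^\top UQ^\top V)$ for $U,V\in T_Q\mathrm{O}(n)$, and the gradient $\nabla_{\mathcal H}F(Q)\in T_Q\mathrm{O}(n)$ is defined by $\mathcal H_Q(\nabla_{\mathcal H}F(Q),\dot Q)=DF(Q)\cdot\dot Q$ for all $\dot Q\in T_Q\mathrm{O}(n)$. *)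

theory Defs
  imports "HOL-Analysis.Analysis"
begin

definition pos_def_mats :: "(real^'n^'n) set" where
  "pos_def_mats = {A. transpose A = A \<and> (\<forall>x. x \<noteq> 0 \<longrightarrow> 0 < x \<bullet> (A *v x))}"

definition pos_diag_mats :: "(real^'n^'n) set" where
  "pos_diag_mats = {A. (\<forall>i j. i \<noteq> j \<longrightarrow> A $ i $ j = 0) \<and> (\<forall>i. 0 < A $ i $ i)}"

definition entropy :: "real^'n^'n \<Rightarrow> real^'n^'n \<Rightarrow> real" where
  "entropy N W = real CARD('n) / 2 - trace (N ** matrix_inv W) / 2
     + ln (det (N ** matrix_inv W)) / 2"

definition congruence :: "real^'n^'n \<Rightarrow> real^'n^'n \<Rightarrow> real^'n^'n" where
  "congruence W1 Q = transpose Q ** W1 ** Q"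

definition pullback_entropy :: "real^'n^'n \<Rightarrow> real^'n^'n \<Rightarrow> real^'n^'n \<Rightarrow> real" where
  "pullback_entropy N W1 Q = entropy N (congruence W1 Q)"

definition orthogonal_group :: "(real^'n^'n) set" where
  "orthogonal_group = {Q. orthogonal_matrix Q}"

text \<open>The tangent space is the set of velocities of curves lying in the group. Since the
  group is an embedded submanifold, it does not matter how smooth the curves are away from
  the base point; differentiability there suffices.\<close>

definition tangent_O :: "real^'n^'n \<Rightarrow> (real^'n^'n) set" where
  "tangent_O Q = {V. \<exists>c. (\<forall>t::real. c t \<in> orthogonal_group) \<and> c 0 = Q \<and>
     (c has_vector_derivative V) (at 0)}"

definition trace_form :: "real^'n^'n \<Rightarrow> real^'n^'n \<Rightarrow> real^'n^'n \<Rightarrow> real" where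
  "trace_form Q U V = trace (transpose Q ** U ** transpose Q ** V)"

text \<open>The functional is differentiated in the ambient matrix space and its derivative is
  then tested on tangent vectors only, which gives the differential of its restriction to
  the group. Differentiability at the base point is part of the condition.\<close>

definition is_gradient_O ::
    "(real^'n^'n \<Rightarrow> real) \<Rightarrow> real^'n^'n \<Rightarrow> real^'n^'n \<Rightarrow> bool" where
  "is_gradient_O f Q G \<longleftrightarrow> f differentiable (at Q) \<and> G \<in> tangent_O Q \<and>
     (\<forall>V\<in>tangent_O Q. trace_form Q G V = frechet_derivative f (at Q) V)"

definition gradient_O :: "(real^'n^'n \<Rightarrow> real) \<Rightarrow> real^'n^'n \<Rightarrow> real^'n^'n" where
  "gradient_O f Q = (THE G. is_gradient_O f Q G)"

definition brockett_field :: "real^'n^'n \<Rightarrow> real^'n^'n \<Rightarrow> real^'n^'n \<Rightarrow> real^'n^'n" where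
  "brockett_field M N Q =
     - (Q ** (N ** transpose Q ** M ** Q - transpose Q ** M ** Q ** N))"

definition solves_flow_O ::
    "(real^'n^'n \<Rightarrow> real^'n^'n) \<Rightarrow> real set \<Rightarrow> (real \<Rightarrow> real^'n^'n) \<Rightarrow> bool" where
  "solves_flow_O X I q \<longleftrightarrow>
     (\<forall>t\<in>I. q t \<in> orthogonal_group \<and> (q has_vector_derivative X (q t)) (at t within I))"

end

theory Submission
  imports Defs
begin

text \<open>On the orthogonal group, \<open>(Q\<^sup>T M\<^sup>-\<^sup>1 Q)\<^sup>-\<^sup>1 = Q\<^sup>T M Q\<close>, so the log-determinant term of the pullback
  entropy is constant there and only \<open>- tr (N Q\<^sup>T M Q) / 2\<close> varies. Differentiating along a curve
  with velocity \<open>Q A\<close>, \<open>A\<close> skew, gives \<open>- tr (N L A) = - tr ((N L - L N) A) / 2\<close> with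
  \<open>L = Q\<^sup>T M Q\<close>, and \<open>N L - L N\<close> is itself skew. The tangent space at \<open>Q\<close> consists of all \<open>Q A\<close> with
  \<open>A\<close> skew, because the Cayley transform provides a curve in the group with any such velocity;
  the trace form is negative definite on it, so the gradient is unique.\<close>

section \<open>Matrix product, transpose and trace as bounded linear operations\<close>

interpretation matrix_mult: bounded_bilinear
  "(**) :: real^'n^'m \<Rightarrow> real^'p^'n \<Rightarrow> real^'p^'m"
proof -
  have "bilinear ((**) :: real^'n^'m \<Rightarrow> real^'p^'n \<Rightarrow> real^'p^'m)"
    unfolding bilinear_def
    by (auto intro!: linearI simp: matrix_matrix_mult_def vec_eq_iff sum.distrib
        sum_distrib_left algebra_simps)
  then show "bounded_bilinear ((**) :: real^'n^'m \<Rightarrow> real^'p^'n \<Rightarrow> real^'p^'m)"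
    by (simp add: bilinear_conv_bounded_bilinear)
qed

lemma bounded_linear_transpose: "bounded_linear (transpose :: real^'n^'m \<Rightarrow> real^'m^'n)"
proof -
  have "linear (transpose :: real^'n^'m \<Rightarrow> real^'m^'n)"
    by (auto intro!: linearI simp: transpose_def vec_eq_iff)
  then show ?thesis
    by (simp add: linear_conv_bounded_linear)
qed

lemmas linear_transpose_simps =
  linear_add[OF bounded_linear.linear[OF bounded_linear_transpose]]
  linear_diff[OF bounded_linear.linear[OF bounded_linear_transpose]]
  linear_neg[OF bounded_linear.linear[OF bounded_linear_transpose]]
  linear_scale[OF bounded_linear.linear[OF bounded_linear_transpose]]

lemmas has_vector_derivative_transpose =
  bounded_linear.has_vector_derivative[OF bounded_linear_transpose]

lemma bounded_linear_trace: "bounded_linear (trace :: real^'n^'n \<Rightarrow> real)"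
proof -
  have "linear (trace :: real^'n^'n \<Rightarrow> real)"
    by (auto intro!: linearI simp: trace_def sum.distrib sum_distrib_left)
  then show ?thesis
    by (simp add: linear_conv_bounded_linear)
qed

lemmas linear_trace_simps =
  linear_add[OF bounded_linear.linear[OF bounded_linear_trace]]
  linear_diff[OF bounded_linear.linear[OF bounded_linear_trace]]
  linear_neg[OF bounded_linear.linear[OF bounded_linear_trace]]
  linear_scale[OF bounded_linear.linear[OF bounded_linear_trace]]

lemmas has_vector_derivative_trace =
  bounded_linear.has_vector_derivative[OF bounded_linear_trace]

lemma differentiable_matrix_mult:
  fixes f :: "'a::real_normed_vector \<Rightarrow> real^'n^'m" and g :: "'a \<Rightarrow> real^'p^'n"
  assumes "f differentiable (at x within S)" and "g differentiable (at x within S)"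
  shows "(\<lambda>x. f x ** g x) differentiable (at x within S)"
  using assms unfolding differentiable_def by (blast intro: matrix_mult.FDERIV)

lemma trace_transpose: "trace (transpose A) = trace A"
  by (simp add: trace_def transpose_def)

text \<open>Links traces of products to the Euclidean inner product, whose definiteness later
  separates two candidate gradients.\<close>

lemma inner_eq_trace: "A \<bullet> B = trace (transpose A ** B)" for A B :: "real^'n^'n"
  unfolding trace_def matrix_matrix_mult_def transpose_def inner_vec_def
  by simp (rule sum.swap)

section \<open>Matrix inversion and its differentiability\<close>

text \<open>\<open>matrix_inv\<close> is a Hilbert choice among two-sided inverses. For square
  matrices a one-sided inverse is two-sided, so \<open>B\<close> witnesses the choice and is the
  only possible outcome.\<close>

lemma matrix_inv_unique: "matrix_inv A = B" if "A ** B = mat 1" for A B :: "real^'n^'n"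
proof -
  have BA: "B ** A = mat 1"
    using that by (simp add: matrix_left_right_inverse)
  have "A ** matrix_inv A = mat 1 \<and> matrix_inv A ** A = mat 1"
    unfolding matrix_inv_def using that BA by (rule_tac someI[of _ B]) simp
  then show ?thesis
    by (metis BA matrix_mul_assoc matrix_mul_lid matrix_mul_rid)
qed

lemma
  fixes A :: "real^'n^'n"
  assumes "det A \<noteq> 0"
  shows matrix_inv_right: "A ** matrix_inv A = mat 1"
    and matrix_inv_left: "matrix_inv A ** A = mat 1"
proof -
  obtain B where "A ** B = mat 1"
    using assms by (metis invertible_det_nz invertible_def)
  then show "A ** matrix_inv A = mat 1"
    using matrix_inv_unique by metis
  then show "matrix_inv A ** A = mat 1"
    by (simp add: matrix_left_right_inverse)
qed

lemma differentiable_prod: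
  fixes f :: "'i \<Rightarrow> 'a::real_normed_vector \<Rightarrow> real"
  assumes "\<And>i. i \<in> I \<Longrightarrow> f i differentiable (at x within S)"
  shows "(\<lambda>x. \<Prod>i\<in>I. f i x) differentiable (at x within S)"
  using assms by (induction I rule: infinite_finite_induct) auto

lemma differentiable_vec_lambda:
  fixes f :: "'a::real_normed_vector \<Rightarrow> real^'n^'m"
  assumes "\<And>i j. (\<lambda>x. f x $ i $ j) differentiable (at x within S)"
  shows "f differentiable (at x within S)"
  unfolding differentiable_componentwise_within[of f]
  using assms by (auto simp: Basis_vec_def inner_axis)

lemma differentiable_vec_nth:
  fixes f :: "'a::real_normed_vector \<Rightarrow> real^'n^'m"
  assumes "f differentiable (at x within S)"
  shows "(\<lambda>x. f x $ i $ j) differentiable (at x within S)"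
proof -
  have "(\<lambda>A. A $ i $ j) differentiable (at (f x) within UNIV)"
    by (intro bounded_linear_imp_differentiable
        bounded_linear_compose[OF bounded_linear_vec_nth bounded_linear_vec_nth])
  then show ?thesis
    using differentiable_compose[OF _ assms, of "\<lambda>A. A $ i $ j"] by simp
qed

lemma differentiable_det:
  fixes f :: "'a::real_normed_vector \<Rightarrow> real^'n^'n"
  assumes "\<And>i j. (\<lambda>x. f x $ i $ j) differentiable (at x within S)"
  shows "(\<lambda>x. det (f x)) differentiable (at x within S)"
  unfolding det_def using assms
  by (auto intro!: differentiable_sum differentiable_mult differentiable_prod)

text \<open>Column \<open>l\<close> of the inverse solves \<open>A *v x = axis l 1\<close>, so
  Cramer's rule applies. Every entry of the inverse thus becomes a quotient of polynomials in the
  entries of \<open>A\<close>.\<close>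

lemma matrix_inv_cramer:
  fixes A :: "real^'n^'n"
  assumes "det A \<noteq> 0"
  shows "matrix_inv A $ k $ l
    = det (\<chi> i j. if j = k then (if i = l then 1 else 0) else A $ i $ j) / det A"
proof -
  have "A *v column l (matrix_inv A) = axis l 1"
    by (metis assms matrix_inv_right matrix_vector_mul_assoc matrix_vector_mul_lid
        matrix_vector_mult_basis)
  then have "column l (matrix_inv A)
      = (\<chi> k. det (\<chi> i j. if j = k then axis l 1 $ i else A $ i $ j) / det A)"
    using cramer[OF assms] by blast
  then have "column l (matrix_inv A) $ k
      = det (\<chi> i j. if j = k then axis l 1 $ i else A $ i $ j) / det A"
    by simp
  then show ?thesis
    by (simp add: column_def axis_def cong: if_cong)
qed

text \<open>Entrywise, the inverse is the differentiable Cramer quotient \<open>?C\<close>. The two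
  are known to agree only where the determinant is nonzero, so the derivative is carried over
  through the openness of that set.\<close>

lemma differentiable_matrix_inv:
  fixes A :: "real^'n^'n"
  assumes "det A \<noteq> 0"
  shows "matrix_inv differentiable (at A)"
proof (rule differentiable_vec_lambda)
  fix k l :: 'n
  let ?S = "{A :: real^'n^'n. det A \<noteq> 0}"
  let ?C = "\<lambda>A :: real^'n^'n.
    det (\<chi> i j. if j = k then (if i = l then 1 else 0) else A $ i $ j) / det A"
  have entry: "(\<lambda>A :: real^'n^'n. A $ i $ j) differentiable (at A)" for i j A
    by (intro differentiable_vec_nth) simp
  have det: "det differentiable (at A)" for A :: "real^'n^'n"
    by (intro differentiable_det entry)
  have S: "open ?S"
    using det by (intro open_Collect_neq continuous_intros continuous_at_imp_continuous_on)
      (auto intro: differentiable_imp_continuous_within)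
  have "?C differentiable (at A)"
  proof (rule differentiable_divide[OF differentiable_det det assms])
    \<comment> \<open>Column \<open>k\<close> of the replaced matrix is constant in
      \<open>A\<close>; every other entry is a coordinate of \<open>A\<close>.\<close>
    show "(\<lambda>A :: real^'n^'n. (\<chi> i j. if j = k then (if i = l then 1 else 0) else A $ i $ j) $ i $ j)
      differentiable (at A)" for i j
      by (cases "j = k") (simp_all add: entry)
  qed
  then obtain D where D: "(?C has_derivative D) (at A)"
    unfolding differentiable_def by blast
  have A: "A \<in> ?S"
    using assms by simp
  have eq: "?C X = matrix_inv X $ k $ l" if "X \<in> ?S" for X
    using that by (intro matrix_inv_cramer[symmetric]) simp
  show "(\<lambda>A. matrix_inv A $ k $ l) differentiable (at A)"
    by (rule differentiableI[OF has_derivative_transform_within_open[OF D S A eq]])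
qed

section \<open>Positive determinants\<close>

text \<open>On the segment from the identity to \<open>A\<close> every matrix is positive definite,
  hence nonsingular. The determinant starts at 1 and, by the intermediate value theorem, could not
  become nonpositive without vanishing on the way.\<close>

lemma det_pos_def_pos:
  assumes "A \<in> pos_def_mats"
  shows "0 < det A"
proof (rule ccontr)
  assume neg: "\<not> 0 < det A"
  define f where "f t = det ((1 - t) *\<^sub>R mat 1 + t *\<^sub>R A)" for t :: real
  have "continuous_on {0..1} f"
    unfolding f_def det_def by (intro continuous_intros)
  then obtain t where t: "0 \<le> t" "t \<le> 1" "f t = 0"
    using IVT2'[of f 1 0 0] neg by (auto simp: f_def)
  then obtain x where x: "x \<noteq> 0" "((1 - t) *\<^sub>R mat 1 + t *\<^sub>R A) *v x = 0"
    unfolding f_def by (metis invertible_det_nz invertible_left_inverse matrix_left_invertible_ker)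
  \<comment> \<open>Pairing the kernel equation with \<open>x\<close> gives a convex combination of
    two positive numbers, which cannot be 0.\<close>
  have "0 = (1 - t) * (x \<bullet> x) + t * (x \<bullet> (A *v x))"
    using arg_cong[OF x(2), of "inner x"]
    by (simp add: matrix_vector_mult_add_rdistrib scaleR_matrix_vector_assoc[symmetric] inner_add_right)
  moreover have "0 < x \<bullet> x" "0 < x \<bullet> (A *v x)"
    using x assms by (auto simp: pos_def_mats_def)
  ultimately show False
    using t by (smt (verit) mult_nonneg_nonneg mult_pos_pos)
qed

lemma det_pos_diag_pos: "0 < det N" if "N \<in> pos_diag_mats"
  using that by (auto simp: pos_diag_mats_def det_diagonal intro!: prod_pos)

section \<open>The Cayley transform of a skew matrix\<close>

text \<open>Skewness gives \<open>x \<bullet> (B *v x) = 0\<close>, so pairing a kernel equation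
  with \<open>x\<close> leaves \<open>x \<bullet> x = 0\<close>.\<close>

lemma det_skew_shift:
  fixes B :: "real^'n^'n"
  assumes "transpose B = - B"
  shows "det (mat 1 - s *\<^sub>R B) \<noteq> 0"
proof -
  have "x = 0" if "(mat 1 - s *\<^sub>R B) *v x = 0" for x
  proof -
    have "x \<bullet> (B *v x) = (transpose B *v x) \<bullet> x"
      by (simp add: dot_lmul_matrix)
    also have "\<dots> = - (x \<bullet> (B *v x))"
      by (simp add: assms inner_commute matrix_vector_mult_def sum_negf inner_vec_def)
    finally have "x \<bullet> (B *v x) = 0" by simp
    then show ?thesis
      using arg_cong[OF that, of "inner x"]
      by (simp add: matrix_vector_mult_diff_rdistrib scaleR_matrix_vector_assoc[symmetric]
          inner_diff_right)
  qed
  then show ?thesis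
    by (metis invertible_det_nz invertible_left_inverse matrix_left_invertible_ker)
qed

text \<open>The factors \<open>P\<close> and \<open>R\<close> are transposes of each other and
  commute, hence so do their inverses \<open>X\<close> and \<open>Y\<close>. Then the product of
  \<open>transpose (X ** R) = P ** Y\<close> with \<open>X ** R\<close> rearranges to
  \<open>P ** X ** Y ** R\<close>, the identity.\<close>

lemma cayley_orthogonal:
  fixes B :: "real^'n^'n"
  assumes "transpose B = - B"
  shows "orthogonal_matrix (matrix_inv (mat 1 - s *\<^sub>R B) ** (mat 1 + s *\<^sub>R B))"
proof -
  define K where "K = s *\<^sub>R B"
  define P where "P = mat 1 - K"
  define R where "R = mat 1 + K"
  have tr: "transpose P = R" "transpose R = P"
    by (simp_all add: P_def R_def K_def linear_transpose_simps assms)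
  define X where "X = matrix_inv P"
  have X: "P ** X = mat 1" "X ** P = mat 1"
    unfolding X_def P_def K_def
    by (simp_all add: matrix_inv_right matrix_inv_left det_skew_shift assms)
  define Y where "Y = transpose X"
  have Y: "R ** Y = mat 1" "Y ** R = mat 1"
    unfolding Y_def using X by (metis tr matrix_transpose_mul transpose_mat)+
  have comm: "P ** R = R ** P"
    by (simp add: P_def R_def matrix_mult.add_left matrix_mult.add_right matrix_mult.diff_left
        matrix_mult.diff_right)
  \<comment> \<open>Both \<open>Y ** X\<close> and \<open>X ** Y\<close> invert the same matrix,
    since \<open>P ** R = R ** P\<close>.\<close>
  have "(P ** R) ** (Y ** X) = mat 1" "(R ** P) ** (X ** Y) = mat 1"
    by (metis X Y matrix_mul_assoc matrix_mul_rid)+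
  then have "Y ** X = X ** Y"
    using matrix_inv_unique comm by metis
  then have "transpose (X ** R) ** (X ** R) = mat 1"
    by (metis X Y Y_def tr matrix_mul_assoc matrix_mul_lid matrix_transpose_mul)
  then show ?thesis
    by (simp add: orthogonal_matrix X_def P_def R_def K_def)
qed

text \<open>Each of the two factors contributes \<open>B / 2\<close> to the velocity at 0; this is
  why the parameter is \<open>t / 2\<close>.\<close>

lemma cayley_has_vector_derivative:
  fixes B :: "real^'n^'n"
  assumes "transpose B = - B"
  shows "((\<lambda>t. matrix_inv (mat 1 - (t / 2) *\<^sub>R B) ** (mat 1 + (t / 2) *\<^sub>R B))
    has_vector_derivative B) (at 0)"
proof -
  define P where "P t = mat 1 - (t / 2) *\<^sub>R B" for t :: real
  define R where "R t = mat 1 + (t / 2) *\<^sub>R B" for t :: real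
  define C where "C t = matrix_inv (P t) ** R t" for t :: real
  have P': "(P has_vector_derivative - (1/2) *\<^sub>R B) (at 0)"
    unfolding P_def by (auto intro!: derivative_eq_intros)
  have R': "(R has_vector_derivative (1/2) *\<^sub>R B) (at 0)"
    unfolding R_def by (auto intro!: derivative_eq_intros)
  have "matrix_inv differentiable (at (P 0))"
    by (simp add: P_def differentiable_matrix_inv)
  then obtain D where "(matrix_inv has_derivative D) (at (P 0))"
    by (auto simp: differentiable_def)
  then have "((matrix_inv \<circ> P) has_vector_derivative D (- (1/2) *\<^sub>R B)) (at 0)"
    by (intro vector_derivative_diff_chain_within[OF P']) (rule has_derivative_at_withinI)
  then obtain E where E: "((\<lambda>t. matrix_inv (P t)) has_vector_derivative E) (at 0)"
    by (auto simp: o_def)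
  have inv0: "matrix_inv (P 0) = mat 1"
    by (simp add: P_def matrix_inv_unique)
  \<comment> \<open>So far the derivative \<open>E\<close> of the inverse is only known to exist.
    Differentiating the constant product \<open>P t ** matrix_inv (P t)\<close> determines
    it.\<close>
  have "((\<lambda>t. P t ** matrix_inv (P t)) has_vector_derivative
      P 0 ** E + (- (1/2) *\<^sub>R B) ** matrix_inv (P 0)) (at 0)"
    by (intro matrix_mult.has_vector_derivative P' E)
  moreover have "(\<lambda>t. P t ** matrix_inv (P t)) = (\<lambda>t. mat 1)"
    by (simp add: P_def matrix_inv_right det_skew_shift assms)
  ultimately have "P 0 ** E + (- (1/2) *\<^sub>R B) ** matrix_inv (P 0) = 0"
    using vector_derivative_unique_at has_vector_derivative_const by metis
  then have "E = (1/2) *\<^sub>R B"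
    unfolding inv0 by (simp add: P_def)
  moreover have "(C has_vector_derivative matrix_inv (P 0) ** ((1/2) *\<^sub>R B) + E ** R 0) (at 0)"
    unfolding C_def by (intro matrix_mult.has_vector_derivative R' E)
  ultimately have "(C has_vector_derivative B) (at 0)"
    unfolding inv0 by (simp add: R_def flip: scaleR_left_distrib)
  then show ?thesis
    unfolding C_def P_def R_def .
qed

section \<open>Tangent space and trace form\<close>

text \<open>Differentiating \<open>transpose (c t) ** c t = mat 1\<close> at 0 shows that
  \<open>transpose Q ** V\<close> is skew. Conversely, the Cayley curve of \<open>B\<close>,
  translated by \<open>Q\<close>, stays in the group for all real \<open>t\<close>, as
  \<open>tangent_O\<close> demands.\<close>

lemma tangent_O_eq:
  assumes "Q \<in> orthogonal_group"
  shows "tangent_O Q = {Q ** B | B. transpose B = - B}"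
proof (intro subset_antisym subsetI)
  fix V assume "V \<in> tangent_O Q"
  then obtain c where c: "\<And>t::real. c t \<in> orthogonal_group" "c 0 = Q"
    and c': "(c has_vector_derivative V) (at 0)"
    by (auto simp: tangent_O_def)
  have "((\<lambda>t. transpose (c t) ** c t) has_vector_derivative
      transpose (c 0) ** V + transpose V ** c 0) (at 0)"
    by (intro matrix_mult.has_vector_derivative has_vector_derivative_transpose c')
  moreover have "(\<lambda>t. transpose (c t) ** c t) = (\<lambda>t. mat 1)"
    using c by (simp add: orthogonal_group_def orthogonal_matrix)
  ultimately have "transpose Q ** V + transpose V ** Q = 0"
    using vector_derivative_unique_at has_vector_derivative_const c(2) by metis
  then have "transpose (transpose Q ** V) = - (transpose Q ** V)"
    by (simp add: matrix_transpose_mul eq_neg_iff_add_eq_0 add.commute)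
  moreover have "V = Q ** (transpose Q ** V)"
    using assms by (simp add: orthogonal_group_def orthogonal_matrix_def matrix_mul_assoc)
  ultimately show "V \<in> {Q ** B | B. transpose B = - B}"
    by blast
next
  fix V assume "V \<in> {Q ** B | B. transpose B = - B}"
  then obtain B where B: "transpose B = - B" "V = Q ** B"
    by blast
  define C where "C t = matrix_inv (mat 1 - (t / 2) *\<^sub>R B) ** (mat 1 + (t / 2) *\<^sub>R B)" for t :: real
  have "Q ** C t \<in> orthogonal_group" for t
    using assms cayley_orthogonal[OF B(1)] unfolding C_def orthogonal_group_def
    by (simp add: orthogonal_matrix_mul)
  moreover have "Q ** C 0 = Q"
    by (simp add: C_def matrix_inv_unique)
  moreover have "((\<lambda>t. Q ** C t) has_vector_derivative V) (at 0)"
    unfolding C_def B(2)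
    by (intro bounded_linear.has_vector_derivative[OF matrix_mult.bounded_linear_right]
        cayley_has_vector_derivative B)
  ultimately show "V \<in> tangent_O Q"
    unfolding tangent_O_def by (intro CollectI exI[of _ "\<lambda>t. Q ** C t"]) auto
qed

lemma trace_form_left_translate:
  assumes "Q \<in> orthogonal_group"
  shows "trace_form Q (Q ** A) (Q ** B) = trace (A ** B)"
proof -
  have QQ: "transpose Q ** Q = mat 1"
    using assms by (simp add: orthogonal_group_def orthogonal_matrix)
  have "transpose Q ** (Q ** A) ** transpose Q ** (Q ** B)
      = (transpose Q ** Q) ** A ** (transpose Q ** Q) ** B"
    by (simp only: matrix_mul_assoc)
  then show ?thesis
    by (simp add: trace_form_def QQ)
qed

text \<open>Both candidates are tested on their own difference \<open>Q ** (A - B)\<close>. For a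
  skew matrix the trace of the square is minus the squared Euclidean norm, so it vanishes only at
  0.\<close>

lemma is_gradient_O_unique:
  assumes Q: "Q \<in> orthogonal_group"
    and G: "is_gradient_O f Q G" and H: "is_gradient_O f Q H"
  shows "G = H"
proof -
  obtain A B where AB: "G = Q ** A" "H = Q ** B" "transpose A = - A" "transpose B = - B"
    using G H tangent_O_eq[OF Q] by (auto simp: is_gradient_O_def)
  have D: "transpose (A - B) = - (A - B)"
    by (simp add: linear_transpose_simps AB)
  then have "Q ** (A - B) \<in> tangent_O Q"
    by (auto simp: tangent_O_eq[OF Q])
  then have "trace_form Q G (Q ** (A - B)) = trace_form Q H (Q ** (A - B))"
    using G H by (simp add: is_gradient_O_def)
  then have "trace ((A - B) ** (A - B)) = 0"
    by (simp add: AB trace_form_left_translate[OF Q] matrix_mult.diff_left linear_trace_simps)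
  then have "(A - B) \<bullet> (A - B) = 0"
    by (simp only: inner_eq_trace D matrix_mult.minus_left linear_trace_simps minus_zero)
  then show ?thesis
    by (simp add: AB)
qed

section \<open>The pullback entropy and its differential on the group\<close>

lemma matrix_inv_congruence:
  assumes "M \<in> pos_def_mats" and "Q \<in> orthogonal_group"
  shows "matrix_inv (congruence (matrix_inv M) Q) = transpose Q ** M ** Q"
proof (rule matrix_inv_unique)
  have M: "matrix_inv M ** M = mat 1"
    using det_pos_def_pos[OF assms(1)] by (intro matrix_inv_left) simp
  have Q: "Q ** transpose Q = mat 1" "transpose Q ** Q = mat 1"
    using assms(2) by (auto simp: orthogonal_group_def orthogonal_matrix_def)
  show "congruence (matrix_inv M) Q ** (transpose Q ** M ** Q) = mat 1"
    unfolding congruence_def by (metis M Q matrix_mul_assoc matrix_mul_rid)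
qed

lemma det_congruence_orthogonal:
  fixes M :: "real^'n^'n"
  assumes "Q \<in> orthogonal_group"
  shows "det (transpose Q ** M ** Q) = det M"
proof -
  have "det Q * det Q = 1"
    using det_orthogonal_matrix[of Q] assms by (auto simp: orthogonal_group_def)
  then have "(det Q * det Q) * det M = det M"
    by simp
  then show ?thesis
    by (simp add: det_mul mult_ac)
qed

text \<open>The formula relies on orthogonality of \<open>Q\<close>, so it is later differentiated
  only along curves inside the group.\<close>

lemma pullback_entropy_orthogonal:
  fixes M :: "real^'n^'n"
  assumes "M \<in> pos_def_mats" and "Q \<in> orthogonal_group"
  shows "pullback_entropy N (matrix_inv M) Q
    = real CARD('n) / 2 - trace (N ** (transpose Q ** M ** Q)) / 2 + ln (det N * det M) / 2"
  unfolding pullback_entropy_def entropy_def matrix_inv_congruence[OF assms] det_mul[of N]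
    det_congruence_orthogonal[OF assms(2)] ..

text \<open>Differentiability in the ambient space follows by composing the congruence with
  inversion, trace, determinant and logarithm. At \<open>Q\<close> this requires a nonsingular
  congruence and a positive argument of \<open>ln\<close>.\<close>

lemma pullback_entropy_differentiable:
  fixes M N :: "real^'n^'n"
  assumes M: "M \<in> pos_def_mats" and N: "N \<in> pos_diag_mats" and Q: "Q \<in> orthogonal_group"
  shows "pullback_entropy N (matrix_inv M) differentiable (at Q)"
proof -
  let ?L = "\<lambda>Q. N ** matrix_inv (congruence (matrix_inv M) Q)"
  have "congruence (matrix_inv M) differentiable (at Q)"
    unfolding congruence_def[abs_def]
    by (intro differentiable_matrix_mult bounded_linear_imp_differentiable
        bounded_linear_transpose differentiable_const differentiable_ident)
  moreover have "det (congruence (matrix_inv M) Q) \<noteq> 0"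
  proof -
    have "det (matrix_inv M) * det M = 1"
      using det_pos_def_pos[OF M]
      by (metis matrix_inv_left det_mul det_I less_irrefl)
    then show ?thesis
      unfolding congruence_def det_congruence_orthogonal[OF Q] by auto
  qed
  ultimately have "(\<lambda>Q. matrix_inv (congruence (matrix_inv M) Q)) differentiable (at Q)"
    using differentiable_chain_at[OF _ differentiable_matrix_inv] by (simp add: o_def)
  then have L: "?L differentiable (at Q)"
    by (intro differentiable_matrix_mult differentiable_const)
  then have tr: "(\<lambda>Q. trace (?L Q)) differentiable (at Q)"
    unfolding differentiable_def using bounded_linear.has_derivative[OF bounded_linear_trace] by blast
  obtain D where det: "((\<lambda>Q. det (?L Q)) has_derivative D) (at Q)"
    using differentiable_det[OF differentiable_vec_nth[OF L]] by (auto simp: differentiable_def)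
  have "0 < det (?L Q)"
    unfolding det_mul[of N] matrix_inv_congruence[OF M Q] det_congruence_orthogonal[OF Q]
    using det_pos_def_pos[OF M] det_pos_diag_pos[OF N] by simp
  then have "(\<lambda>Q. ln (det (?L Q))) differentiable (at Q)"
    by (intro differentiableI[OF has_derivative_ln[OF _ det]])
  then show ?thesis
    unfolding pullback_entropy_def[abs_def] entropy_def using tr
    by (intro differentiable_add differentiable_diff differentiable_divide differentiable_const) auto
qed

text \<open>By the chain rule, the ambient derivative in direction \<open>V\<close> is the
  derivative of the entropy along any group curve with velocity \<open>V\<close>, and there the
  closed form applies.\<close>

lemma frechet_derivative_pullback_entropy:
  fixes M N :: "real^'n^'n"
  assumes M: "M \<in> pos_def_mats" and N: "N \<in> pos_diag_mats" and Q: "Q \<in> orthogonal_group"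
    and V: "V \<in> tangent_O Q"
  shows "frechet_derivative (pullback_entropy N (matrix_inv M)) (at Q) V
    = - trace (N ** transpose Q ** M ** V)"
proof -
  let ?F = "pullback_entropy N (matrix_inv M)"
  obtain c where c: "\<And>t::real. c t \<in> orthogonal_group" "c 0 = Q"
    and c': "(c has_vector_derivative V) (at 0)"
    using V by (auto simp: tangent_O_def)
  have "(?F has_derivative frechet_derivative ?F (at Q)) (at Q)"
    using pullback_entropy_differentiable[OF M N Q] by (simp add: frechet_derivative_works)
  then have 1: "((?F \<circ> c) has_vector_derivative frechet_derivative ?F (at Q) V) (at 0)"
    using c by (intro vector_derivative_diff_chain_within[OF c']) (simp add: has_derivative_at_withinI)
  let ?T = "trace (N ** ((transpose Q ** M) ** V + (transpose V ** M) ** Q))"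
  have "((\<lambda>t. trace (N ** ((transpose (c t) ** M) ** c t))) has_vector_derivative ?T) (at 0)"
    unfolding c(2)[symmetric]
    by (intro has_vector_derivative_trace matrix_mult.has_vector_derivative c'
        bounded_linear.has_vector_derivative[OF matrix_mult.bounded_linear_right]
        bounded_linear.has_vector_derivative[OF matrix_mult.bounded_linear_left]
        has_vector_derivative_transpose)
  then have "((\<lambda>t. real CARD('n) / 2 - trace (N ** ((transpose (c t) ** M) ** c t)) / 2
      + ln (det N * det M) / 2) has_vector_derivative - ?T / 2) (at 0)"
    by (auto intro!: derivative_eq_intros simp flip: has_real_derivative_iff_has_vector_derivative)
  then have "((?F \<circ> c) has_vector_derivative - ?T / 2) (at 0)"
    using c(1) by (simp add: o_def pullback_entropy_orthogonal[OF M])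
  then have "frechet_derivative ?F (at Q) V = - ?T / 2"
    using 1 vector_derivative_unique_at by blast
  \<comment> \<open>By symmetry of \<open>M\<close> and \<open>N\<close>, transposition and
    cyclicity of the trace identify the two product rule terms; their sum cancels the factor
    1/2.\<close>
  moreover have "trace (N ** (transpose V ** M ** Q)) = trace (N ** (transpose Q ** M ** V))"
  proof -
    have "transpose M = M" "transpose N = N"
      using M N by (auto simp: pos_def_mats_def pos_diag_mats_def transpose_def vec_eq_iff) metis
    then have "transpose (N ** (transpose V ** M ** Q)) = (transpose Q ** M ** V) ** N"
      by (simp add: matrix_transpose_mul matrix_mul_assoc)
    then show ?thesis
      by (metis trace_transpose trace_mul_sym)
  qed
  ultimately have "frechet_derivative ?F (at Q) V = - trace (N ** (transpose Q ** M ** V))"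
    by (simp add: matrix_mult.add_right linear_trace_simps)
  then show ?thesis
    by (simp only: matrix_mul_assoc)
qed

section \<open>The gradient and its flow\<close>

lemma is_gradient_O_brockett:
  fixes M N :: "real^'n^'n"
  assumes M: "M \<in> pos_def_mats" and N: "N \<in> pos_diag_mats" and Q: "Q \<in> orthogonal_group"
  shows "is_gradient_O (pullback_entropy N (matrix_inv M)) Q ((1/2) *\<^sub>R brockett_field M N Q)"
proof -
  define L where "L = transpose Q ** M ** Q"
  \<comment> \<open>Since \<open>A\<close> is skew, \<open>trace (N ** L ** A)\<close> sees only the
    skew part of \<open>N ** L\<close>, which is half the commutator because \<open>N\<close> and
    \<open>L\<close> are symmetric. The minus sign is that of the differential.\<close>
  define B where "B = - (1/2) *\<^sub>R (N ** L - L ** N)"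
  have sym: "transpose M = M" "transpose N = N"
    using M N by (auto simp: pos_def_mats_def pos_diag_mats_def transpose_def vec_eq_iff) metis
  then have "transpose L = L"
    by (simp add: L_def matrix_transpose_mul matrix_mul_assoc)
  then have skew: "transpose B = - B"
    by (simp add: B_def linear_transpose_simps matrix_transpose_mul sym
        flip: scaleR_minus_right)
  have G: "(1/2) *\<^sub>R brockett_field M N Q = Q ** B"
    by (simp add: brockett_field_def B_def L_def matrix_mult.scaleR_right matrix_mult.minus_right
        matrix_mul_assoc)
  have "trace_form Q (Q ** B) (Q ** A) = - trace (N ** transpose Q ** M ** (Q ** A))"
    if A: "transpose A = - A" for A
  proof -
    \<comment> \<open>Transposing shows that both halves of the commutator contribute equally to
      \<open>trace (B ** A)\<close>.\<close>
    have "trace (L ** N ** A) = trace (transpose (L ** N ** A))"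
      by (simp add: trace_transpose)
    also have "transpose (L ** N ** A) = - (A ** (N ** L))"
      by (simp add: matrix_transpose_mul A sym \<open>transpose L = L\<close> matrix_mult.minus_left)
    also have "trace \<dots> = - trace (N ** L ** A)"
      by (simp only: linear_trace_simps trace_mul_sym[of A])
    finally have "trace (B ** A) = - trace (N ** L ** A)"
      by (simp add: B_def matrix_mult.scaleR_left matrix_mult.diff_left matrix_mult.minus_left
          linear_trace_simps)
    then show ?thesis
      by (simp add: trace_form_left_translate[OF Q] L_def matrix_mul_assoc)
  qed
  then show ?thesis
    unfolding is_gradient_O_def G
    using pullback_entropy_differentiable[OF M N Q] skew
      frechet_derivative_pullback_entropy[OF M N Q]
    by (auto simp: tangent_O_eq[OF Q])
qed

theorem corollary1:
  fixes M N W1 :: "real^'n^'n"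
  assumes "M \<in> pos_def_mats" and "N \<in> pos_diag_mats" and "W1 = matrix_inv M"
  shows "(\<forall>Q\<in>orthogonal_group.
            (\<exists>!G. is_gradient_O (pullback_entropy N W1) Q G) \<and>
            gradient_O (pullback_entropy N W1) Q = (1/2) *\<^sub>R brockett_field M N Q) \<and>
         (\<forall>I q. is_interval I \<longrightarrow>
            (solves_flow_O (gradient_O (pullback_entropy N W1)) I q \<longleftrightarrow>
             solves_flow_O (\<lambda>Q. (1/2) *\<^sub>R brockett_field M N Q) I q))"
proof -
  have ex1: "\<exists>!G. is_gradient_O (pullback_entropy N W1) Q G"
    and grad: "gradient_O (pullback_entropy N W1) Q = (1/2) *\<^sub>R brockett_field M N Q"
    if "Q \<in> orthogonal_group" for Q
    using is_gradient_O_brockett[OF assms(1,2) that] is_gradient_O_unique[OF that]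
    unfolding assms(3) gradient_O_def by (blast, blast)
  \<comment> \<open>A solution of either flow lies in the group by definition of
    \<open>solves_flow_O\<close>, and there the two fields coincide.\<close>
  then show ?thesis
    by (auto simp: solves_flow_O_def)
qed

end
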